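(* Let $\mathcal{S}$ be a semi-quadratic Weingarten surface with Weingarten relation $W(k_1,k_2)=\alpha k_1k_2+\beta k_1+\gamma k_2+\delta=0$, and let $p\in\mathcal{S}$ be an umbilic point. Then the relation is an elliptic PDE at $p$ if and only if $\Lambda_2>\Lambda_1^2$.
   Context: A semi-quadratic Weingarten surface is a $C^2$-smooth oriented surface in Euclidean 3-space whose principal curvatures $k_1,k_2$ satisfy $\alpha k_1k_2+\beta k_1+\gamma k_2+\delta=0$ for fixed real constants $\alpha,\beta,\gamma,\delta$. Put $\Lambda_1=\beta-\gamma$ and $\Lambda_2=(\beta+\gamma)^2-4\alpha\delta$. A point is umbilic if $k_1=k_2$ there. A Weingarten relation $W(k_1,k_2)=0$ satisfied by $\mathcal{S}$ is elliptic (as a second-order PDE) at $q\in\mathcal{S}$ if and only if $\left.\left(\frac{\partial W}{\partial k_1}\cdot\frac{\partial W}{\partial k_2}\right)\right|_q>0$, the partial derivatives being evaluated at $(k_1(q),k_2(q))$; this is taken as the definition of ellipticity. *)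

theory Defs
  imports "HOL-Analysis.Analysis"
begin

(* X is twice continuously differentiable on the open set U, with injective differential.
   X' and X'' are its first and second total derivatives. *)
definition C2_immersion_on :: "(real^2) set \<Rightarrow> (real^2 \<Rightarrow> real^3) \<Rightarrow> bool" where
  "C2_immersion_on U X \<longleftrightarrow> open U \<and>
     (\<exists>(X' :: real^2 \<Rightarrow> ((real^2) \<Rightarrow>\<^sub>L (real^3)))
       (X'' :: real^2 \<Rightarrow> ((real^2) \<Rightarrow>\<^sub>L ((real^2) \<Rightarrow>\<^sub>L (real^3)))).
        (\<forall>u\<in>U. (X has_derivative blinfun_apply (X' u)) (at u)) \<and>
        (\<forall>u\<in>U. (X' has_derivative blinfun_apply (X'' u)) (at u)) \<and>
        continuous_on U X'' \<and>
        (\<forall>u\<in>U. inj (blinfun_apply (X' u))))"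

(* Surfaces may be immersed: M is the underlying space and f its map into Euclidean 3-space.
   An embedded surface S is the case M = top_of_set S, f = id. No atlas is part of the data:
   the transition map between two local parametrizations in the sense below is automatically
   a C^2 diffeomorphism, so that f determines the differentiable structure. *)
definition local_parametrization ::
    "'m topology \<Rightarrow> ('m \<Rightarrow> real^3) \<Rightarrow> (real^2) set \<Rightarrow> (real^2 \<Rightarrow> 'm) \<Rightarrow> bool" where
  "local_parametrization M f U x \<longleftrightarrow>
     openin M (x ` U) \<and>
     homeomorphic_map (top_of_set U) (subtopology M (x ` U)) x \<and>
     C2_immersion_on U (f \<circ> x)"

definition C2_surface :: "'m topology \<Rightarrow> ('m \<Rightarrow> real^3) \<Rightarrow> bool" where
  "C2_surface M f \<longleftrightarrow> Hausdorff_space M \<and> second_countable M \<and>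
     (\<forall>p\<in>topspace M. \<exists>U x. local_parametrization M f U x \<and> p \<in> x ` U)"

(* An orientation is a continuous choice of unit normal (a Gauss map) N. *)
definition oriented_C2_surface ::
    "'m topology \<Rightarrow> ('m \<Rightarrow> real^3) \<Rightarrow> ('m \<Rightarrow> real^3) \<Rightarrow> bool" where
  "oriented_C2_surface M f N \<longleftrightarrow> C2_surface M f \<and>
     continuous_map M euclidean N \<and>
     (\<forall>p\<in>topspace M. norm (N p) = 1) \<and>
     (\<forall>U x u w. local_parametrization M f U x \<and> u \<in> U \<longrightarrow>
        N (x u) \<bullet> frechet_derivative (f \<circ> x) (at u) w = 0)"

(* a and b are the principal curvatures at p, with multiplicity: the tangent plane has an
   orthonormal basis e1, e2 with dN(e1) = - a e1 and dN(e2) = - b e2, i.e. a and b are the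
   eigenvalues of the shape operator -dN. In a local parametrization x with x u = p,
   tangent vectors are e = d(f o x)(w), and dN(e) is d(N o x)(w). *)
definition principal_curvatures_at ::
    "'m topology \<Rightarrow> ('m \<Rightarrow> real^3) \<Rightarrow> ('m \<Rightarrow> real^3) \<Rightarrow> 'm \<Rightarrow> real \<Rightarrow> real \<Rightarrow> bool" where
  "principal_curvatures_at M f N p a b \<longleftrightarrow>
     (\<exists>U x u D D\<^sub>N w\<^sub>1 w\<^sub>2.
        local_parametrization M f U x \<and> u \<in> U \<and> x u = p \<and>
        ((f \<circ> x) has_derivative D) (at u) \<and> ((N \<circ> x) has_derivative D\<^sub>N) (at u) \<and>
        norm (D w\<^sub>1) = 1 \<and> norm (D w\<^sub>2) = 1 \<and> D w\<^sub>1 \<bullet> D w\<^sub>2 = 0 \<and>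
        D\<^sub>N w\<^sub>1 = - (a *\<^sub>R D w\<^sub>1) \<and> D\<^sub>N w\<^sub>2 = - (b *\<^sub>R D w\<^sub>2))"

(* k1, k2 label the two principal curvatures at every point. The relation W need not be
   symmetric, so the labelling matters; no convention such as k1 >= k2 is imposed. *)
definition principal_curvatures ::
    "'m topology \<Rightarrow> ('m \<Rightarrow> real^3) \<Rightarrow> ('m \<Rightarrow> real^3) \<Rightarrow> ('m \<Rightarrow> real) \<Rightarrow> ('m \<Rightarrow> real) \<Rightarrow> bool" where
  "principal_curvatures M f N k\<^sub>1 k\<^sub>2 \<longleftrightarrow>
     (\<forall>p\<in>topspace M. principal_curvatures_at M f N p (k\<^sub>1 p) (k\<^sub>2 p))"

definition semi_quadratic :: "real \<Rightarrow> real \<Rightarrow> real \<Rightarrow> real \<Rightarrow> real \<Rightarrow> real \<Rightarrow> real" where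
  "semi_quadratic \<alpha> \<beta> \<gamma> \<delta> x y = \<alpha> * x * y + \<beta> * x + \<gamma> * y + \<delta>"

definition satisfies_Weingarten_relation ::
    "'m topology \<Rightarrow> ('m \<Rightarrow> real) \<Rightarrow> ('m \<Rightarrow> real) \<Rightarrow> (real \<Rightarrow> real \<Rightarrow> real) \<Rightarrow> bool" where
  "satisfies_Weingarten_relation M k\<^sub>1 k\<^sub>2 W \<longleftrightarrow> (\<forall>q\<in>topspace M. W (k\<^sub>1 q) (k\<^sub>2 q) = 0)"

definition semi_quadratic_Weingarten_surface ::
    "'m topology \<Rightarrow> ('m \<Rightarrow> real^3) \<Rightarrow> ('m \<Rightarrow> real^3) \<Rightarrow> ('m \<Rightarrow> real) \<Rightarrow> ('m \<Rightarrow> real) \<Rightarrow>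
     real \<Rightarrow> real \<Rightarrow> real \<Rightarrow> real \<Rightarrow> bool" where
  "semi_quadratic_Weingarten_surface M f N k\<^sub>1 k\<^sub>2 \<alpha> \<beta> \<gamma> \<delta> \<longleftrightarrow>
     oriented_C2_surface M f N \<and> principal_curvatures M f N k\<^sub>1 k\<^sub>2 \<and>
     satisfies_Weingarten_relation M k\<^sub>1 k\<^sub>2 (semi_quadratic \<alpha> \<beta> \<gamma> \<delta>)"

definition umbilic :: "('m \<Rightarrow> real) \<Rightarrow> ('m \<Rightarrow> real) \<Rightarrow> 'm \<Rightarrow> bool" where
  "umbilic k\<^sub>1 k\<^sub>2 p \<longleftrightarrow> k\<^sub>1 p = k\<^sub>2 p"

definition elliptic_at ::
    "(real \<Rightarrow> real \<Rightarrow> real) \<Rightarrow> ('m \<Rightarrow> real) \<Rightarrow> ('m \<Rightarrow> real) \<Rightarrow> 'm \<Rightarrow> bool" where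
  "elliptic_at W k\<^sub>1 k\<^sub>2 q \<longleftrightarrow>
     deriv (\<lambda>x. W x (k\<^sub>2 q)) (k\<^sub>1 q) * deriv (\<lambda>y. W (k\<^sub>1 q) y) (k\<^sub>2 q) > 0"

definition Lambda1 :: "real \<Rightarrow> real \<Rightarrow> real" where
  "Lambda1 \<beta> \<gamma> = \<beta> - \<gamma>"

definition Lambda2 :: "real \<Rightarrow> real \<Rightarrow> real \<Rightarrow> real \<Rightarrow> real" where
  "Lambda2 \<alpha> \<beta> \<gamma> \<delta> = (\<beta> + \<gamma>)\<^sup>2 - 4 * \<alpha> * \<delta>"

end

theory Submission
  imports Defs
begin

text \<open>Let k be the common principal curvature at the umbilic. The partial derivatives of the relation
  there are \<alpha> k + \<beta> and \<alpha> k + \<gamma>; their product differs from \<beta> \<gamma> - \<alpha> \<delta> by \<alpha> times the value of the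
  relation at (k, k), which vanishes. On the other hand, Lambda2 - Lambda1^2 = 4 (\<beta> \<gamma> - \<alpha> \<delta>).\<close>

lemma deriv_semi_quadratic_fst: "deriv (\<lambda>x. semi_quadratic \<alpha> \<beta> \<gamma> \<delta> x y) x = \<alpha> * y + \<beta>"
  unfolding semi_quadratic_def by (rule DERIV_imp_deriv) (auto intro!: derivative_eq_intros)

lemma deriv_semi_quadratic_snd: "deriv (semi_quadratic \<alpha> \<beta> \<gamma> \<delta> x) y = \<alpha> * x + \<gamma>"
  unfolding semi_quadratic_def by (rule DERIV_imp_deriv) (auto intro!: derivative_eq_intros)

text \<open>Polarization: (\<beta> + \<gamma>)^2 - (\<beta> - \<gamma>)^2 = 4 \<beta> \<gamma>. In
  this form, comparing \<open>Lambda2\<close> with the square of \<open>Lambda1\<close> is a sign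
  question.\<close>

lemma Lambda2_eq:
  "Lambda2 \<alpha> \<beta> \<gamma> \<delta> = (Lambda1 \<beta> \<gamma>)\<^sup>2 + 4 * (\<beta> * \<gamma> - \<alpha> * \<delta>)"
  unfolding Lambda1_def Lambda2_def by algebra

theorem proposition4p19:
  fixes M :: "'m topology" and f N :: "'m \<Rightarrow> real^3" and k\<^sub>1 k\<^sub>2 :: "'m \<Rightarrow> real"
    and \<alpha> \<beta> \<gamma> \<delta> :: real and p :: 'm
  assumes "semi_quadratic_Weingarten_surface M f N k\<^sub>1 k\<^sub>2 \<alpha> \<beta> \<gamma> \<delta>"
    and "p \<in> topspace M" and "umbilic k\<^sub>1 k\<^sub>2 p"
  shows "elliptic_at (semi_quadratic \<alpha> \<beta> \<gamma> \<delta>) k\<^sub>1 k\<^sub>2 p \<longleftrightarrow>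
         Lambda2 \<alpha> \<beta> \<gamma> \<delta> > (Lambda1 \<beta> \<gamma>)\<^sup>2"
proof -
  define k where "k = k\<^sub>1 p"
  have k: "k\<^sub>1 p = k" "k\<^sub>2 p = k"
    using assms(3) by (simp_all add: k_def umbilic_def)
  have "semi_quadratic \<alpha> \<beta> \<gamma> \<delta> (k\<^sub>1 p) (k\<^sub>2 p) = 0"
    using assms(1,2)
    by (simp add: semi_quadratic_Weingarten_surface_def satisfies_Weingarten_relation_def)
  then have "\<alpha> * k * k + \<beta> * k + \<gamma> * k + \<delta> = 0"
    by (simp add: k semi_quadratic_def)
  then have "(\<alpha> * k + \<beta>) * (\<alpha> * k + \<gamma>) = \<beta> * \<gamma> - \<alpha> * \<delta>"
    by algebra
  \<comment> \<open>Each partial derivative depends on the other curvature: the first on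
    \<open>k\<^sub>2 p\<close>, the second on \<open>k\<^sub>1 p\<close>. Umbilicity makes both
    equal to \<open>k\<close>, so the product just computed is the one in
    \<open>elliptic_at\<close>.\<close>
  then have "elliptic_at (semi_quadratic \<alpha> \<beta> \<gamma> \<delta>) k\<^sub>1 k\<^sub>2 p \<longleftrightarrow> \<beta> * \<gamma> - \<alpha> * \<delta> > 0"
    by (simp add: elliptic_at_def deriv_semi_quadratic_fst deriv_semi_quadratic_snd k)
  also have "\<dots> \<longleftrightarrow> Lambda2 \<alpha> \<beta> \<gamma> \<delta> > (Lambda1 \<beta> \<gamma>)\<^sup>2"
    by (simp add: Lambda2_eq)
  finally show ?thesis .
qed

end
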